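(* Assume $d\ge 11$, $p\ge\max\{3,p_{JL}(d)\}$, $\sqrt\Delta>2$, and let $\ell\in\mathbb N$ with $\ell>\frac\alpha2$. Let $a^*,b^*>0$ be small enough (in particular $1+aP_{2\ell}(z)\ge\frac12$ for all $z\in\mathbb R$ and $0<a\le a^*$). Assume that $(a,b)\in\mathcal C^1([\tau_0,\tau^*],(0,a^*]\times(0,b^*])$. Then $$\partial_\tau\Phi_{a,b}-\Delta\Phi_{a,b}+\frac12\Lambda\Phi_{a,b}-\Phi_{a,b}|\Phi_{a,b}|^{p-1}=\Psi_1$$ with $$\Psi_1=\left[\frac12\left(-\frac{b_\tau}b+1\right)-\frac\ell\alpha-\frac1{2\alpha}\frac{\partial_\tau\nu}{1+\nu}\right]\Lambda_r\Phi_{a,b}+\frac\ell\alpha\Lambda Q_b(r)+\tilde\Psi_1$$ and $$\tilde\Psi_1=\frac\ell\alpha\left[\frac1{\mu^\gamma}\Lambda Q_b\left(\frac r\mu\right)-\Lambda Q_b(r)\right]-\frac1{\alpha^2}\left(\frac{\partial_z\nu}{1+\nu}\right)^2\frac1{\mu^{\frac2{p-1}}}\left(\Lambda^2Q_b+\alpha\Lambda Q_b\right)\left(\frac r\mu\right).$$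
   Context: Numbers. $p_{JL}(d)=1+\frac{4}{d-4-2\sqrt{d-1}}$, $c_\infty=\left[\frac{2}{p-1}\left(d-2-\frac{2}{p-1}\right)\right]^{\frac1{p-1}}$, $\Delta=(d-2)^2-4p\,c_\infty^{p-1}$ (as a number), $\gamma=\frac{d-2-\sqrt\Delta}{2}$, $\alpha=\gamma-\frac{2}{p-1}>2$. Space variable $Y=(y,z)\in\mathbb R^d\times\mathbb R$, $r=|y|$; in the equation, $\Delta=\partial_r^2+\frac{d-1}r\partial_r+\partial_z^2$ is the Laplacian on $\mathbb R^{d+1}$ acting on functions of $(r,z)$. $\Lambda_r=\frac2{p-1}+r\partial_r$, $\Lambda=\Lambda_r+z\partial_z$ (so $\Lambda=\Lambda_r$ on functions of $r$ only). $Q(r)$ is the unique (positive) radial solution on $\mathbb R^d$ of $Q''+\frac{d-1}rQ'+Q^p=0$, $Q(0)=1$, $Q'(0)=0$; $Q_b(r)=b^{-\frac1{p-1}}Q(r/\sqrt b)$. Expressions such as $\Lambda Q_b(\frac r\mu)$ mean $(\Lambda Q_b)$ evaluated at $\frac r\mu$, and $\Lambda^2Q_b=\Lambda(\Lambda Q_b)$. $P_m(z)=c_m\sum_{k=0}^{[m/2]}\frac{m!}{k!(m-2k)!}(-1)^kz^{m-2k}$ ($c_m>0$) is the Hermite polynomial solving $-P_m''+\frac12zP_m'=\frac m2P_m$, normalized in $L^2(\frac1{2\sqrt\pi}e^{-z^2/4}dz)$. $\nu=\nu(\tau,z)=a(\tau)P_{2\ell}(z)$, $\mu=(1+\nu)^{\frac1\alpha}$,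 $D=\sqrt b\,\mu$, and $\Phi_{a,b}(r,z)=\frac1{D^{\frac2{p-1}}}Q\left(\frac rD\right)=\frac1{\mu^{\frac2{p-1}}}Q_b\left(\frac r\mu\right)$, with $a=a(\tau)$, $b=b(\tau)$; $b_\tau=\frac{db}{d\tau}$.
   Formalization: The coefficient of ∂_τν/(1+ν) in Ψ_1 is corrected from −1/(2α) to −1/α: since D=√b(1+ν)^{1/α}, the printed identity fails, e.g. at r=0 whenever a_τ P_{2ℓ}(z)≠0. *)

theory Defs
  imports "HOL-Analysis.Analysis"
begin

definition p_JL :: "nat \<Rightarrow> real" where
  "p_JL d = 1 + 4 / (real d - 4 - 2 * sqrt (real d - 1))"

definition c_inf :: "nat \<Rightarrow> real \<Rightarrow> real" where
  "c_inf d p = (2 / (p - 1) * (real d - 2 - 2 / (p - 1))) powr (1 / (p - 1))"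

text \<open>The number denoted \<open>\<Delta>\<close> in the source, not the Laplacian.\<close>

definition Discr :: "nat \<Rightarrow> real \<Rightarrow> real" where
  "Discr d p = (real d - 2)\<^sup>2 - 4 * p * c_inf d p powr (p - 1)"

definition gamma_exp :: "nat \<Rightarrow> real \<Rightarrow> real" where
  "gamma_exp d p = (real d - 2 - sqrt (Discr d p)) / 2"

definition alpha_exp :: "nat \<Rightarrow> real \<Rightarrow> real" where
  "alpha_exp d p = gamma_exp d p - 2 / (p - 1)"

text \<open>Second pure partial derivatives summed over an orthonormal basis. For the basis of
  \<open>real ^ 'n \<times> real\<close> and a function of \<open>r = norm y\<close> and \<open>z\<close> this is
  \<open>\<partial>\<^sub>r\<^sup>2 + (d - 1) / r \<partial>\<^sub>r + \<partial>\<^sub>z\<^sup>2\<close> with \<open>d = CARD('n)\<close> where \<open>r > 0\<close>; it also makes sense on the axis \<open>r = 0\<close>.\<close>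

definition laplacian :: "('a::euclidean_space \<Rightarrow> real) \<Rightarrow> 'a \<Rightarrow> real" where
  "laplacian u x = (\<Sum>e\<in>Basis. (deriv ^^ 2) (\<lambda>t. u (x + t *\<^sub>R e)) 0)"

text \<open>Profiles are functions of \<open>r \<ge> 0\<close>, extended arbitrarily to \<open>r < 0\<close>. Only the
  values on \<open>r \<ge> 0\<close> matter below: at \<open>r = 0\<close> the two-sided derivative \<open>deriv\<close> is multiplied by \<open>0\<close>.\<close>

definition Lambda_r :: "real \<Rightarrow> (real \<Rightarrow> real) \<Rightarrow> real \<Rightarrow> real" where
  "Lambda_r p f r = 2 / (p - 1) * f r + r * deriv f r"

definition Lambda :: "real \<Rightarrow> (real \<Rightarrow> real \<Rightarrow> real) \<Rightarrow> real \<Rightarrow> real \<Rightarrow> real" where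
  "Lambda p u r z = Lambda_r p (\<lambda>s. u s z) r + z * deriv (u r) z"

definition radial_profile :: "nat \<Rightarrow> real \<Rightarrow> (real \<Rightarrow> real) \<Rightarrow> bool" where
  "radial_profile d p Q \<longleftrightarrow>
     (\<exists>Q' Q''. (\<forall>r\<ge>0. (Q has_real_derivative Q' r) (at r within {0..})) \<and>
              (\<forall>r\<ge>0. (Q' has_real_derivative Q'' r) (at r within {0..})) \<and>
              continuous_on {0..} Q'' \<and>
              (\<forall>r>0. Q'' r + (real d - 1) / r * Q' r + Q r powr p = 0) \<and>
              (\<forall>r\<ge>0. Q r > 0) \<and> Q 0 = 1 \<and> Q' 0 = 0)"

definition Q_b :: "real \<Rightarrow> (real \<Rightarrow> real) \<Rightarrow> real \<Rightarrow> real \<Rightarrow> real" where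
  "Q_b p Q b r = b powr (- 1 / (p - 1)) * Q (r / sqrt b)"

definition hermite_raw :: "nat \<Rightarrow> real \<Rightarrow> real" where
  "hermite_raw m z =
     (\<Sum>k\<le>m div 2. fact m / (fact k * fact (m - 2 * k)) * (-1) ^ k * z ^ (m - 2 * k))"

text \<open>The factor \<open>c\<^sub>m > 0\<close> making \<open>P\<^sub>m\<close> a unit vector of \<open>L\<^sup>2(1 / (2 \<surd>\<pi>) e\<^bsup>-z\<^sup>2/4\<^esup> dz)\<close>.\<close>

definition hermite_const :: "nat \<Rightarrow> real" where
  "hermite_const m =
     1 / sqrt (LINT z|lborel. (hermite_raw m z)\<^sup>2 * (1 / (2 * sqrt pi) * exp (- z\<^sup>2 / 4)))"

definition hermite_P :: "nat \<Rightarrow> real \<Rightarrow> real" where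
  "hermite_P m z = hermite_const m * hermite_raw m z"

definition C1_on :: "real set \<Rightarrow> (real \<Rightarrow> real) \<Rightarrow> bool" where
  "C1_on T f \<longleftrightarrow>
     (\<exists>f'. (\<forall>t\<in>T. (f has_real_derivative f' t) (at t within T)) \<and> continuous_on T f')"

text \<open>Time derivative on an interval \<open>T\<close>, one-sided at its end points.\<close>

definition dtime :: "real set \<Rightarrow> (real \<Rightarrow> real) \<Rightarrow> real \<Rightarrow> real" where
  "dtime T f t = vector_derivative f (at t within T)"

definition nu :: "nat \<Rightarrow> (real \<Rightarrow> real) \<Rightarrow> real \<Rightarrow> real \<Rightarrow> real" where
  "nu l a t z = a t * hermite_P (2 * l) z"

definition mu :: "nat \<Rightarrow> real \<Rightarrow> nat \<Rightarrow> (real \<Rightarrow> real) \<Rightarrow> real \<Rightarrow> real \<Rightarrow> real" where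
  "mu d p l a t z = (1 + nu l a t z) powr (1 / alpha_exp d p)"

definition D_scale ::
  "nat \<Rightarrow> real \<Rightarrow> nat \<Rightarrow> (real \<Rightarrow> real) \<Rightarrow> (real \<Rightarrow> real) \<Rightarrow> real \<Rightarrow> real \<Rightarrow> real" where
  "D_scale d p l a b t z = sqrt (b t) * mu d p l a t z"

definition Phi ::
  "nat \<Rightarrow> real \<Rightarrow> nat \<Rightarrow> (real \<Rightarrow> real) \<Rightarrow> (real \<Rightarrow> real) \<Rightarrow> (real \<Rightarrow> real) \<Rightarrow>
     real \<Rightarrow> real \<Rightarrow> real \<Rightarrow> real" where
  "Phi d p l Q a b t r z =
     1 / D_scale d p l a b t z powr (2 / (p - 1)) * Q (r / D_scale d p l a b t z)"

definition Psi1_tilde ::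
  "nat \<Rightarrow> real \<Rightarrow> nat \<Rightarrow> (real \<Rightarrow> real) \<Rightarrow> (real \<Rightarrow> real) \<Rightarrow> (real \<Rightarrow> real) \<Rightarrow>
     real \<Rightarrow> real \<Rightarrow> real \<Rightarrow> real" where
  "Psi1_tilde d p l Q a b t r z =
     (let \<alpha> = alpha_exp d p; \<gamma> = gamma_exp d p; \<mu> = mu d p l a t z;
          LQ = Lambda_r p (Q_b p Q (b t)); LLQ = Lambda_r p LQ in
      real l / \<alpha> * (1 / \<mu> powr \<gamma> * LQ (r / \<mu>) - LQ r)
      - 1 / \<alpha>\<^sup>2 * (deriv (nu l a t) z / (1 + nu l a t z))\<^sup>2
          * (1 / \<mu> powr (2 / (p - 1))) * (LLQ (r / \<mu>) + \<alpha> * LQ (r / \<mu>)))"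

text \<open>\<open>T\<close> is the time interval. Since \<open>D = \<surd>b (1 + \<nu>)\<^bsup>1/\<alpha>\<^esup>\<close>, one has
  \<open>\<partial>\<^sub>\<tau>D / D = b\<^sub>\<tau> / (2 b) + (1/\<alpha>) \<partial>\<^sub>\<tau>\<nu> / (1 + \<nu>)\<close>, so that \<open>\<partial>\<^sub>\<tau>\<nu> / (1 + \<nu>)\<close> enters with coefficient
  \<open>-1/\<alpha>\<close>; the value \<open>-1/(2\<alpha>)\<close> printed in the source is a misprint.\<close>

definition Psi1 ::
  "nat \<Rightarrow> real \<Rightarrow> nat \<Rightarrow> (real \<Rightarrow> real) \<Rightarrow> real set \<Rightarrow> (real \<Rightarrow> real) \<Rightarrow> (real \<Rightarrow> real) \<Rightarrow>
     real \<Rightarrow> real \<Rightarrow> real \<Rightarrow> real" where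
  "Psi1 d p l Q T a b t r z =
     (let \<alpha> = alpha_exp d p in
      (1 / 2 * (- dtime T b t / b t + 1) - real l / \<alpha>
         - 1 / \<alpha> * (dtime T (\<lambda>s. nu l a s z) t / (1 + nu l a t z)))
        * Lambda_r p (\<lambda>s. Phi d p l Q a b t s z) r
      + real l / \<alpha> * Lambda_r p (Q_b p Q (b t)) r
      + Psi1_tilde d p l Q a b t r z)"

end

theory Submission
  imports Defs
begin

text \<open>
  The function \<open>\<Phi>\<close> is the stationary profile \<open>Q\<close> dilated by \<open>D = \<surd>b (1 + \<nu>)\<^bsup>1/\<alpha>\<^esup>\<close>. Everything becomes
  transparent in the logarithmic scale \<open>w = ln D = ln b / 2 + ln (1 + \<nu>) / \<alpha>\<close>: with \<open>q = 2 / (p - 1)\<close>,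
  the dilated function is \<open>e\<^bsup>-qw\<^esup> g (r e\<^bsup>-w\<^esup>)\<close>, and differentiating it in \<open>w\<close> replaces \<open>g\<close> by
  \<open>-\<Lambda>g\<close> (\<open>log_dilation_has_derivative\<close>). So \<open>\<tau>\<close> and \<open>z\<close> derivatives of \<open>\<Phi>\<close> are derivatives of \<open>w\<close>
  times \<open>X\<close> and \<open>Y\<close>, the dilations of \<open>\<Lambda>Q\<close> and \<open>\<Lambda>\<^sup>2Q\<close>:
  \<open>\<partial>\<^sub>\<tau>\<Phi> = - w\<^sub>\<tau> X\<close>, \<open>\<partial>\<^sub>z\<Phi> = - w\<^sub>z X\<close>, \<open>\<partial>\<^sub>z\<^sup>2\<Phi> = - w\<^sub>z\<^sub>z X + w\<^sub>z\<^sup>2 Y\<close>, and \<open>X = \<Lambda>\<^sub>r\<Phi>\<close>.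

  The equation for \<open>Q\<close> is invariant under this dilation, because \<open>q p = q + 2\<close>. Hence the Laplacian in
  \<open>y\<close> cancels the nonlinearity (\<open>laplacian_log_dilation_profile\<close>), and the left-hand side is
  \<open>(1/2 - w\<^sub>\<tau> + w\<^sub>z\<^sub>z - z w\<^sub>z / 2) X - w\<^sub>z\<^sup>2 Y\<close>. Here \<open>\<alpha> w\<^sub>z = \<nu>\<^sub>z / (1 + \<nu>)\<close> and
  \<open>\<alpha> w\<^sub>z\<^sub>z = \<nu>\<^sub>z\<^sub>z / (1 + \<nu>) - (\<nu>\<^sub>z / (1 + \<nu>))\<^sup>2\<close>. The Hermite equation (\<open>hermite_P_ode\<close>) gives
  \<open>\<nu>\<^sub>z\<^sub>z - z \<nu>\<^sub>z / 2 = - l \<nu>\<close>, and \<open>\<nu> / (1 + \<nu>) = 1 - 1 / (1 + \<nu>)\<close> splits the outcome into the term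
  \<open>- l/\<alpha>\<close> of the bracket and \<open>(l/\<alpha>) X / (1 + \<nu>)\<close>. As \<open>\<mu>\<^bsup>\<alpha>\<^esup> = 1 + \<nu>\<close> and \<open>\<gamma> = \<alpha> + q\<close>, the latter is
  \<open>(l/\<alpha>) \<mu>\<^bsup>-\<gamma>\<^esup> \<Lambda>Q\<^sub>b (r/\<mu>)\<close>, to which \<open>(l/\<alpha>) \<Lambda>Q\<^sub>b (r)\<close> is added and subtracted. The
  quadratic part of \<open>w\<^sub>z\<^sub>z X - w\<^sub>z\<^sup>2 Y\<close> is \<open>-\<alpha>\<^sup>-\<^sup>2 (\<nu>\<^sub>z / (1 + \<nu>))\<^sup>2 (Y + \<alpha> X)\<close>, the remaining term.

  To include the axis \<open>y = 0\<close>, the profile is replaced by its even extension \<open>Q \<bar>s\<bar>\<close>, which is twice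
  differentiable on the whole line since \<open>Q' 0 = 0\<close>; the equation at the origin,
  \<open>d Q'' 0 + Q\<^sup>p = 0\<close>, is the limit of the radial one.
\<close>

section \<open>Second derivatives and the Laplacian\<close>

lemma second_deriv_eqI:
  fixes f f1 :: "real \<Rightarrow> real"
  assumes "\<forall>\<^sub>F s in nhds x. (f has_real_derivative f1 s) (at s)"
    and "(f1 has_real_derivative f2) (at x)"
  shows "(deriv ^^ 2) f x = f2"
proof -
  have "\<forall>\<^sub>F s in nhds x. deriv f s = f1 s"
    using assms(1) by eventually_elim (rule DERIV_imp_deriv)
  then have "deriv (deriv f) x = deriv f1 x"
    by (rule deriv_cong_ev) simp
  then show ?thesis
    using DERIV_imp_deriv[OF assms(2)] by (simp add: numeral_2_eq_2)
qed

lemma second_deriv_shift: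
  fixes f :: "real \<Rightarrow> real"
  shows "(deriv ^^ 2) (\<lambda>t. f (z + t)) 0 = (deriv ^^ 2) f z"
proof -
  have shift: "deriv (\<lambda>t. g (z + t)) = (\<lambda>t. deriv g (z + t))" for g :: "real \<Rightarrow> real"
    using DERIV_shift[of g _ _ z] by (simp add: deriv_def fun_eq_iff add.commute)
  show ?thesis
    by (simp add: numeral_2_eq_2 shift)
qed

lemma laplacian_prod_real:
  fixes U :: "'a::euclidean_space \<Rightarrow> real \<Rightarrow> real"
  shows "laplacian (\<lambda>Y. U (fst Y) (snd Y)) (y, z) = laplacian (\<lambda>x. U x z) y + (deriv ^^ 2) (U y) z"
proof -
  have "sum f Basis = (\<Sum>i\<in>Basis. f (i, 0)) + f (0, 1)" for f :: "'a \<times> real \<Rightarrow> real"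
  proof -
    have "inj_on (\<lambda>u. (u::'a, 0::real)) Basis"
      by (auto intro!: inj_onI)
    then show ?thesis
      unfolding Basis_prod_def by (subst sum.union_disjoint) (auto simp: sum.reindex)
  qed
  then show ?thesis
    by (simp add: laplacian_def second_deriv_shift)
qed

text \<open>Along a line through \<open>x\<close> the squared norm is a quadratic polynomial \<open>\<phi>\<close>, positive near \<open>x \<noteq> 0\<close>.\<close>

lemma second_deriv_radial:
  fixes x e :: "'a::euclidean_space" and G G1 G2 :: "real \<Rightarrow> real"
  assumes G: "\<And>s. (G has_real_derivative G1 s) (at s)"
    and G1: "\<And>s. (G1 has_real_derivative G2 s) (at s)"
    and x: "x \<noteq> 0" and e: "norm e = 1"
  shows "(deriv ^^ 2) (\<lambda>t. G (norm (x + t *\<^sub>R e))) 0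
    = G2 (norm x) * ((x \<bullet> e)\<^sup>2 / (norm x)\<^sup>2) + G1 (norm x) * (1 / norm x - (x \<bullet> e)\<^sup>2 / norm x ^ 3)"
proof -
  define \<phi> where "\<phi> t = (norm x)\<^sup>2 + 2 * t * (x \<bullet> e) + t\<^sup>2" for t
  have ee: "e \<bullet> e = 1"
    using e by (simp add: dot_square_norm)
  have norm_eq: "norm (x + t *\<^sub>R e) = sqrt (\<phi> t)" for t
    by (simp add: norm_eq_sqrt_inner inner_add_left inner_add_right \<phi>_def ee inner_commute
        power2_eq_square algebra_simps)
  have \<phi>0: "\<phi> 0 = (norm x)\<^sup>2" and r: "norm x > 0"
    using x by (simp_all add: \<phi>_def)
  have d\<phi>: "(\<phi> has_real_derivative 2 * (x \<bullet> e) + 2 * t) (at t)" for t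
    unfolding \<phi>_def by (auto intro!: derivative_eq_intros)
  have dsqrt: "((\<lambda>t. sqrt (\<phi> t)) has_real_derivative ((x \<bullet> e) + t) / sqrt (\<phi> t)) (at t)" if "\<phi> t > 0" for t
    using that by (auto intro!: derivative_eq_intros d\<phi> simp: field_simps)
  have "isCont \<phi> 0"
    using d\<phi> by (rule DERIV_isCont)
  then have "(\<phi> \<longlongrightarrow> \<phi> 0) (nhds 0)"
    unfolding isCont_def tendsto_at_iff_tendsto_nhds .
  then have ev: "\<forall>\<^sub>F t in nhds 0. \<phi> t > 0"
    using r \<phi>0 by (auto intro: order_tendstoD(1))
  show ?thesis
    unfolding norm_eq
  proof (rule second_deriv_eqI)
    show "\<forall>\<^sub>F t in nhds 0. ((\<lambda>t. G (sqrt (\<phi> t))) has_real_derivative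
        G1 (sqrt (\<phi> t)) * (((x \<bullet> e) + t) / sqrt (\<phi> t))) (at t)"
      using ev by eventually_elim (rule DERIV_chain2[OF G dsqrt])
    have p0: "\<phi> 0 > 0" and s0: "sqrt (\<phi> 0) = norm x"
      using \<phi>0 r by simp_all
    show "((\<lambda>t. G1 (sqrt (\<phi> t)) * (((x \<bullet> e) + t) / sqrt (\<phi> t))) has_real_derivative
        G2 (norm x) * ((x \<bullet> e)\<^sup>2 / (norm x)\<^sup>2)
          + G1 (norm x) * (1 / norm x - (x \<bullet> e)\<^sup>2 / norm x ^ 3)) (at 0)"
    proof (rule DERIV_cong)
      have num: "((\<lambda>t. (x \<bullet> e) + t) has_real_derivative 1) (at 0)"
        by (auto intro!: derivative_eq_intros)
      have "sqrt (\<phi> 0) \<noteq> 0" using p0 by simp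
      note DERIV_divide[OF num dsqrt[OF p0] this]
      from DERIV_mult[OF DERIV_chain2[OF G1 dsqrt[OF p0]] this]
      show "((\<lambda>t. G1 (sqrt (\<phi> t)) * (((x \<bullet> e) + t) / sqrt (\<phi> t))) has_real_derivative
          G2 (norm x) * ((x \<bullet> e) / norm x) * ((x \<bullet> e) / norm x)
          + (norm x - (x \<bullet> e) * ((x \<bullet> e) / norm x)) / (norm x * norm x) * G1 (norm x)) (at 0)"
        by (simp add: s0)
    qed (use r in \<open>simp add: field_simps power2_eq_square power3_eq_cube\<close>)
  qed
qed

text \<open>Off the origin, summing \<open>second_deriv_radial\<close> over a basis leaves one full second derivative by
  Parseval's identity. At the origin each coordinate line sees the even function \<open>G\<close> itself, which
  is why evenness is needed.\<close>

lemma laplacian_radial: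
  fixes x :: "'a::euclidean_space" and G G1 G2 :: "real \<Rightarrow> real"
  assumes G: "\<And>s. (G has_real_derivative G1 s) (at s)"
    and G1: "\<And>s. (G1 has_real_derivative G2 s) (at s)"
    and even: "\<And>s. G (- s) = G s"
  shows "laplacian (\<lambda>x. G (norm x)) x =
    (if x = 0 then real DIM('a) * G2 0
     else G2 (norm x) + (real DIM('a) - 1) / norm x * G1 (norm x))"
proof (cases "x = 0")
  case True
  have "G \<bar>s\<bar> = G s" for s
    using even[of s] by (simp add: abs_if)
  moreover have "(deriv ^^ 2) G 0 = G2 0"
    by (rule second_deriv_eqI) (use G G1 in auto)
  ultimately show ?thesis
    using True by (simp add: laplacian_def)
next
  case False
  then have r: "norm x > 0" by simp
  have parseval: "(\<Sum>e\<in>Basis. (x \<bullet> e)\<^sup>2) = (norm x)\<^sup>2"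
    using euclidean_inner[of x x] by (simp add: power2_eq_square dot_square_norm)
  have "laplacian (\<lambda>x. G (norm x)) x = (\<Sum>e\<in>Basis. G2 (norm x) / (norm x)\<^sup>2 * (x \<bullet> e)\<^sup>2
      + (G1 (norm x) / norm x - G1 (norm x) / norm x ^ 3 * (x \<bullet> e)\<^sup>2))"
    unfolding laplacian_def
    by (intro sum.cong refl)
      (use False in \<open>simp add: second_deriv_radial[OF G G1] algebra_simps\<close>)
  also have "\<dots> = G2 (norm x) / (norm x)\<^sup>2 * (norm x)\<^sup>2
      + (real DIM('a) * (G1 (norm x) / norm x) - G1 (norm x) / norm x ^ 3 * (norm x)\<^sup>2)"
    unfolding sum.distrib sum_subtractf sum_distrib_left[symmetric] parseval by simp
  also have "\<dots> = G2 (norm x) + (real DIM('a) - 1) / norm x * G1 (norm x)"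
    using r by (simp add: field_simps power2_eq_square power3_eq_cube)
  finally show ?thesis using False by simp
qed

section \<open>The profile as a smooth even function\<close>

text \<open>For \<open>\<sigma> = 1\<close> and \<open>\<sigma> = -1\<close> these are the even and odd extensions of a function on the half line;
  the compatibility conditions force \<open>f' 0 = 0\<close> in the even case and \<open>f 0 = 0\<close> in the odd one.\<close>

lemma has_real_derivative_reflect:
  fixes f f1 :: "real \<Rightarrow> real"
  assumes f: "\<And>s. s \<ge> 0 \<Longrightarrow> (f has_real_derivative f1 s) (at s within {0..})"
    and compat: "f 0 = \<sigma> * f 0" "f1 0 = - \<sigma> * f1 0"
  shows "((\<lambda>s. if s \<ge> 0 then f s else \<sigma> * f (- s)) has_real_derivative
    (if x \<ge> 0 then f1 x else - \<sigma> * f1 (- x))) (at x)"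
    (is "(?F has_real_derivative ?F1 x) _")
proof -
  have right: "(?F has_real_derivative ?F1 s) (at s within {0..})" if "s \<ge> 0" for s
    by (rule has_field_derivative_transform_within[OF _ zero_less_one]) (use f that in auto)
  have left: "(?F has_real_derivative ?F1 s) (at s within {..0})" if "s \<le> 0" for s
  proof -
    have "((f \<circ> uminus) has_real_derivative f1 (- s) * (- 1)) (at s within {..0})"
      by (rule DERIV_image_chain) (use f[of "- s"] that in \<open>auto intro!: derivative_eq_intros\<close>)
    then have "((\<lambda>s. \<sigma> * f (- s)) has_real_derivative \<sigma> * (f1 (- s) * (- 1))) (at s within {..0})"
      unfolding comp_def by (rule DERIV_cmult)
    moreover have "\<sigma> * (f1 (- s) * (- 1)) = ?F1 s"
    proof (cases "s = 0")
      case True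
      then show ?thesis using compat(2) by simp
    qed (use that in simp)
    ultimately have "((\<lambda>s. \<sigma> * f (- s)) has_real_derivative ?F1 s) (at s within {..0})"
      by simp
    then show ?thesis
    proof (rule has_field_derivative_transform_within[OF _ zero_less_one])
      fix t :: real assume "t \<in> {..0}"
      then show "\<sigma> * f (- t) = ?F t"
        using compat(1) by (cases "t = 0") auto
    qed (use that in simp)
  qed
  consider "x > 0" | "x < 0" | "x = 0" by linarith
  then show ?thesis
  proof cases
    case 1
    then show ?thesis
      using right[of x] at_within_interior[of x "{0..}"] by simp
  next
    case 2
    then show ?thesis
      using left[of x] at_within_interior[of x "{..0}"] by simp
  next
    case 3
    then show ?thesis
      using right[of x] left[of x] unfolding has_field_derivative_iff
      by (intro Lim_Un_univ[where S = "{0..}" and T = "{..0}"]) auto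
  qed
qed

lemma radial_profile_pos:
  assumes "radial_profile d p Q" "r \<ge> 0"
  shows "Q r > 0"
  using assms unfolding radial_profile_def by blast

text \<open>Letting \<open>r \<rightarrow> 0\<close> in the radial equation turns \<open>(d - 1) Q'(r) / r\<close> into \<open>(d - 1) Q''(0)\<close>, because
  \<open>Q'(0) = 0\<close>; this gives the equation at the origin.\<close>

lemma radial_profile_even_extension:
  assumes prof: "radial_profile d p Q"
  obtains Q1 Q2 :: "real \<Rightarrow> real" where
    "\<And>s. ((\<lambda>s. Q \<bar>s\<bar>) has_real_derivative Q1 s) (at s)"
    "\<And>s. (Q1 has_real_derivative Q2 s) (at s)"
    "real d * Q2 0 = - (Q 0 powr p)"
    "\<And>s. s > 0 \<Longrightarrow> Q2 s + (real d - 1) / s * Q1 s = - (Q s powr p)"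
proof -
  obtain R1 R2 where R:
    "\<And>r. r \<ge> 0 \<Longrightarrow> (Q has_real_derivative R1 r) (at r within {0..})"
    "\<And>r. r \<ge> 0 \<Longrightarrow> (R1 has_real_derivative R2 r) (at r within {0..})"
    "continuous_on {0..} R2"
    "\<And>r. r > 0 \<Longrightarrow> R2 r + (real d - 1) / r * R1 r + Q r powr p = 0"
    "R1 0 = 0"
    using prof unfolding radial_profile_def by metis
  \<comment> \<open>\<open>Q\<close> is extended evenly, hence \<open>Q'\<close> oddly.\<close>
  have 1: "((\<lambda>s. if s \<ge> 0 then Q s else 1 * Q (- s)) has_real_derivative
      (if x \<ge> 0 then R1 x else - 1 * R1 (- x))) (at x)" for x
    by (rule has_real_derivative_reflect) (use R in auto)
  have 2: "((\<lambda>s. if s \<ge> 0 then R1 s else (- 1) * R1 (- s)) has_real_derivative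
      (if x \<ge> 0 then R2 x else - (- 1) * R2 (- x))) (at x)" for x
    by (rule has_real_derivative_reflect) (use R in auto)
  have at_right: "at_right 0 \<le> at (0::real) within {0..}"
    by (rule at_le) auto
  have cont: "(g \<longlongrightarrow> g 0) (at_right 0)" if "continuous_on {0..} g" for g :: "real \<Rightarrow> real"
    using that filterlim_mono[OF _ order_refl at_right, of g "nhds (g 0)"]
    by (auto simp: continuous_on_def)
  have Qc: "continuous_on {0..} Q"
    using R(1) by (auto intro!: DERIV_continuous_on)
  have "((\<lambda>r. (R1 r - R1 0) / (r - 0)) \<longlongrightarrow> R2 0) (at_right 0)"
    using R(2)[of 0] filterlim_mono[OF _ order_refl at_right]
    by (auto simp: has_field_derivative_iff)
  then have "((\<lambda>r. R2 r + (real d - 1) * ((R1 r - R1 0) / (r - 0)) + Q r powr p) \<longlongrightarrow>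
      R2 0 + (real d - 1) * R2 0 + Q 0 powr p) (at_right 0)"
    using radial_profile_pos[OF prof, of 0] by (intro tendsto_intros cont[OF R(3)] cont[OF Qc]) auto
  moreover have "\<forall>\<^sub>F r in at_right 0. R2 r + (real d - 1) * ((R1 r - R1 0) / (r - 0)) + Q r powr p = 0"
    using R(4) R(5) by (auto simp: eventually_at_filter)
  ultimately have "((\<lambda>r. 0) \<longlongrightarrow> R2 0 + (real d - 1) * R2 0 + Q 0 powr p) (at_right (0::real))"
    using tendsto_cong by force
  then have "R2 0 + (real d - 1) * R2 0 + Q 0 powr p = 0"
    by (simp add: tendsto_const_iff)
  then have 3: "real d * R2 0 = - (Q 0 powr p)"
    by (simp add: algebra_simps)
  have abs_eq: "(\<lambda>s. if s \<ge> 0 then Q s else 1 * Q (- s)) = (\<lambda>s. Q \<bar>s\<bar>)"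
    by (auto simp: abs_if)
  show thesis
    by (rule that[OF 1[unfolded abs_eq] 2]) (use 3 R(4) in \<open>auto simp: eq_neg_iff_add_eq_0\<close>)
qed

section \<open>Hermite polynomials\<close>

text \<open>On the monomial \<open>z\<^bsup>m - 2k\<^esup>\<close> the operator \<open>m/2 - (z/2) \<partial>\<^sub>z\<close> is multiplication by \<open>k\<close>, and
  \<open>-\<partial>\<^sub>z\<^sup>2\<close> maps the \<open>k\<close>-th term of the polynomial to \<open>k + 1\<close> times the next one; so both give the
  same sum, called \<open>\<Sum> B k\<close> below, up to a shift of the index.\<close>

lemma hermite_raw_ode:
  obtains H1 H2 where
    "\<And>z. (hermite_raw m has_real_derivative H1 z) (at z)"
    "\<And>z. (H1 has_real_derivative H2 z) (at z)"
    "\<And>z. - H2 z + z / 2 * H1 z = real m / 2 * hermite_raw m z"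
proof -
  define A :: "nat \<Rightarrow> real" where "A k = fact m / (fact k * fact (m - 2 * k)) * (-1) ^ k" for k
  define H1 where "H1 z = (\<Sum>k\<le>m div 2. A k * (real (m - 2 * k) * z ^ (m - 2 * k - 1)))" for z
  define H2 where "H2 z = (\<Sum>k\<le>m div 2. A k * (real (m - 2 * k) *
      (real (m - 2 * k - 1) * z ^ (m - 2 * k - 2))))" for z
  have H: "hermite_raw m = (\<lambda>z. \<Sum>k\<le>m div 2. A k * z ^ (m - 2 * k))"
    by (simp add: hermite_raw_def A_def fun_eq_iff)
  have "(hermite_raw m has_real_derivative H1 z) (at z)" for z
    unfolding H H1_def by (auto intro!: derivative_eq_intros sum.cong)
  moreover have "(H1 has_real_derivative H2 z) (at z)" for z
    unfolding H1_def H2_def by (auto intro!: derivative_eq_intros sum.cong simp: numeral_2_eq_2)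
  moreover have "- H2 z + z / 2 * H1 z = real m / 2 * hermite_raw m z" for z
  proof -
    define B where "B k = real k * A k * z ^ (m - 2 * k)" for k
    \<comment> \<open>The last index, \<open>k = m div 2\<close>, contributes nothing: its exponent is \<open>0\<close> or \<open>1\<close>.\<close>
    have step: "- (A k * (real (m - 2 * k) * (real (m - 2 * k - 1) * z ^ (m - 2 * k - 2)))) =
        (if k < m div 2 then B (Suc k) else 0)" if "k \<le> m div 2" for k
    proof (cases "k < m div 2")
      case True
      then have "2 \<le> m - 2 * k" by linarith
      then obtain j where j: "m - 2 * k = Suc (Suc j)"
        by (metis add_2_eq_Suc le_Suc_ex)
      then have j': "m - 2 * Suc k = j" by simp
      have "A k * (real (Suc (Suc j)) * real (Suc j)) = fact m / (fact k * fact j) * (- 1) ^ k"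
        by (simp add: A_def j del: of_nat_Suc)
      moreover have "real (Suc k) * A (Suc k) = - (fact m / (fact k * fact j) * (- 1) ^ k)"
        unfolding A_def j' by (simp del: of_nat_Suc)
      ultimately have "- (A k * (real (Suc (Suc j)) * real (Suc j))) * z ^ j
          = real (Suc k) * A (Suc k) * z ^ j"
        by simp
      then show ?thesis
        using True unfolding B_def j' j by (simp add: mult.assoc del: of_nat_Suc)
    next
      case False
      then have "m - 2 * k = 0 \<or> m - 2 * k - 1 = 0" using that by linarith
      then show ?thesis using False by auto
    qed
    have "- H2 z = (\<Sum>k\<le>m div 2. if k < m div 2 then B (Suc k) else 0)"
      unfolding H2_def sum_negf[symmetric] by (intro sum.cong refl step) simp
    also have "\<dots> = (\<Sum>k<m div 2. B (Suc k))"
      by (rule sum.mono_neutral_cong_right) auto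
    also have "\<dots> = (\<Sum>k\<le>m div 2. B k)"
      by (simp add: sum.atMost_shift B_def)
    finally have "- H2 z + z / 2 * H1 z =
        (\<Sum>k\<le>m div 2. B k + z / 2 * (A k * (real (m - 2 * k) * z ^ (m - 2 * k - 1))))"
      by (simp add: H1_def sum.distrib sum_distrib_left)
    also have "\<dots> = (\<Sum>k\<le>m div 2. real m / 2 * (A k * z ^ (m - 2 * k)))"
    proof (intro sum.cong refl)
      fix k assume "k \<in> {..m div 2}"
      then have k: "2 * k \<le> m" by auto
      have "z * (real (m - 2 * k) * z ^ (m - 2 * k - 1)) = real (m - 2 * k) * z ^ (m - 2 * k)"
        by (cases "m - 2 * k") auto
      then have "z / 2 * (A k * (real (m - 2 * k) * z ^ (m - 2 * k - 1)))
          = A k / 2 * (real (m - 2 * k) * z ^ (m - 2 * k))" by simp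
      then show "B k + z / 2 * (A k * (real (m - 2 * k) * z ^ (m - 2 * k - 1)))
          = real m / 2 * (A k * z ^ (m - 2 * k))"
        using k by (simp add: B_def of_nat_diff field_simps)
    qed
    finally show ?thesis by (simp add: H sum_distrib_left)
  qed
  ultimately show thesis by (rule that)
qed

lemma hermite_P_ode:
  obtains P1 P2 where
    "\<And>z. (hermite_P m has_real_derivative P1 z) (at z)"
    "\<And>z. (P1 has_real_derivative P2 z) (at z)"
    "\<And>z. - P2 z + z / 2 * P1 z = real m / 2 * hermite_P m z"
proof -
  obtain H1 H2 where H:
    "\<And>z. (hermite_raw m has_real_derivative H1 z) (at z)"
    "\<And>z. (H1 has_real_derivative H2 z) (at z)"
    "\<And>z. - H2 z + z / 2 * H1 z = real m / 2 * hermite_raw m z"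
    using hermite_raw_ode[of m] by blast
  have "hermite_P m = (\<lambda>z. hermite_const m * hermite_raw m z)"
    by (simp add: hermite_P_def fun_eq_iff)
  moreover have "- (hermite_const m * H2 z) + z / 2 * (hermite_const m * H1 z)
      = real m / 2 * (hermite_const m * hermite_raw m z)" for z
    using arg_cong[OF H(3)[of z], of "\<lambda>u. hermite_const m * u"] by (simp add: algebra_simps)
  ultimately show thesis
    using that[of "\<lambda>z. hermite_const m * H1 z" "\<lambda>z. hermite_const m * H2 z"]
      DERIV_cmult[OF H(1)] DERIV_cmult[OF H(2)] by simp
qed

section \<open>The exponents\<close>

text \<open>With \<open>q = 2 / (p - 1)\<close>, the discriminant is \<open>(d - 2 - 2q)\<^sup>2 - 8 (d - 2 - q)\<close>, so its square root stays
  below \<open>d - 2 - 2q\<close>; this is the claim, as \<open>2\<alpha>\<close> is the difference of the two.\<close>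

lemma alpha_exp_pos:
  assumes "d \<ge> 11" "p \<ge> 3"
  shows "alpha_exp d p > 0"
proof -
  define q where "q = 2 / (p - 1)"
  have q: "0 < q" "q \<le> 1" and pq: "p * q = q + 2"
    using assms(2) by (simp_all add: q_def field_simps)
  have base: "q * (real d - 2 - q) > 0"
    using q assms(1) by simp
  have "c_inf d p powr (p - 1) = q * (real d - 2 - q)"
    using base assms(2) by (simp add: c_inf_def powr_powr flip: q_def)
  then have "Discr d p = (real d - 2)\<^sup>2 - 4 * (p * q) * (real d - 2 - q)"
    by (simp add: Discr_def)
  also have "\<dots> = (real d - 2 - 2 * q)\<^sup>2 - 8 * (real d - 2 - q)"
    unfolding pq by (simp add: power2_eq_square algebra_simps)
  also have "\<dots> < (real d - 2 - 2 * q)\<^sup>2"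
    using q assms(1) by simp
  finally have "sqrt (Discr d p) < real d - 2 - 2 * q"
    using q assms(1) real_sqrt_less_mono real_sqrt_abs by fastforce
  then show ?thesis
    by (simp add: alpha_exp_def gamma_exp_def flip: q_def)
qed


section \<open>Dilations in logarithmic scale\<close>

text \<open>The scale enters through its logarithm \<open>w\<close> because dilations form a one-parameter group in \<open>w\<close>,
  whose generator is \<open>-\<Lambda>\<close> with \<open>\<Lambda> g = q g + s g'\<close>.\<close>

definition log_dilation :: "real \<Rightarrow> (real \<Rightarrow> real) \<Rightarrow> real \<Rightarrow> real \<Rightarrow> real" where
  "log_dilation q g w r = exp (- (q * w)) * g (r * exp (- w))"

lemma log_dilation_has_derivative:
  assumes g: "\<And>s. (g has_real_derivative g1 s) (at s)"
    and w: "(w has_real_derivative w') (at x within S)"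
  shows "((\<lambda>x. log_dilation q g (w x) r) has_real_derivative
    - w' * log_dilation q (\<lambda>s. q * g s + s * g1 s) (w x) r) (at x within S)"
  unfolding log_dilation_def
  by (rule derivative_eq_intros w DERIV_chain2[OF g] refl | simp)+
    (simp add: algebra_simps)

text \<open>\<open>Lambda_r\<close> commutes with scaling. Only the values of \<open>f\<close> on the half line are prescribed: at \<open>r = 0\<close>
  the factor \<open>r\<close> removes \<open>deriv f\<close>, and for \<open>r > 0\<close> a neighbourhood of \<open>r\<close> lies in the half line. So \<open>g\<close>
  may be the even extension of a profile.\<close>

lemma Lambda_r_scaled:
  assumes f: "\<And>s. s \<ge> 0 \<Longrightarrow> f s = c * g (k * s)"
    and g: "\<And>s. (g has_real_derivative g1 s) (at s)"
    and r: "r \<ge> 0"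
  shows "Lambda_r p f r = c * (2 / (p - 1) * g (k * r) + k * r * g1 (k * r))"
proof (cases "r = 0")
  case True
  then show ?thesis using f[of 0] by (simp add: Lambda_r_def)
next
  case False
  then have r: "r > 0" using r by simp
  have "((\<lambda>s. c * g (k * s)) has_real_derivative c * (g1 (k * r) * k)) (at r)"
    by (intro DERIV_cmult DERIV_chain2[OF g]) (auto intro!: derivative_eq_intros)
  then have "(f has_real_derivative c * (g1 (k * r) * k)) (at r)"
    by (rule has_field_derivative_transform_within_open[of _ _ _ "{0<..}"]) (use r f in auto)
  then have "deriv f r = c * (g1 (k * r) * k)" by (rule DERIV_imp_deriv)
  then show ?thesis using f[of r] r by (simp add: Lambda_r_def algebra_simps)
qed

text \<open>Dilated profiles are again stationary: the Laplacian produces the factor \<open>e\<^bsup>-(q + 2)w\<^esup>\<close> and the power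
  the factor \<open>e\<^bsup>-qpw\<^esup>\<close>, which agree for \<open>q = 2 / (p - 1)\<close>.\<close>

lemma laplacian_log_dilation_profile:
  fixes y :: "'a::euclidean_space"
  assumes prof: "radial_profile DIM('a) p Q" and p: "p > 1"
  shows "laplacian (\<lambda>x. log_dilation (2 / (p - 1)) (\<lambda>s. Q \<bar>s\<bar>) w (norm x)) y
    = - (log_dilation (2 / (p - 1)) (\<lambda>s. Q \<bar>s\<bar>) w (norm y) powr p)"
proof -
  obtain Q1 Q2 where Q1: "\<And>s. ((\<lambda>s. Q \<bar>s\<bar>) has_real_derivative Q1 s) (at s)"
    and Q2: "\<And>s. (Q1 has_real_derivative Q2 s) (at s)"
    and ode0: "real DIM('a) * Q2 0 = - (Q 0 powr p)"
    and ode: "\<And>s. s > 0 \<Longrightarrow> Q2 s + (real DIM('a) - 1) / s * Q1 s = - (Q s powr p)"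
    using radial_profile_even_extension[OF prof] by blast
  define q where "q = 2 / (p - 1)"
  define E e where "E = exp (- (q * w))" and "e = exp (- w)"
  have qp: "q * p = q + 2"
    using p by (simp add: q_def field_simps)
  have e: "e > 0" by (simp add: e_def)
  have Qpos: "Q s > 0" if "s \<ge> 0" for s
    using radial_profile_pos[OF prof that] .
  have "E powr p = exp (- (q * p) * w)"
    by (simp add: E_def powr_def)
  also have "\<dots> = E * e * e"
    unfolding qp E_def e_def by (simp add: algebra_simps flip: exp_add)
  finally have Ep: "E powr p = E * e * e" .
  have dil: "log_dilation q (\<lambda>s. Q \<bar>s\<bar>) w = (\<lambda>s. E * Q \<bar>s * e\<bar>)"
    by (simp add: log_dilation_def E_def e_def fun_eq_iff)
  have scale: "((\<lambda>s. s * e) has_real_derivative e) (at s)" for s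
    by (auto intro!: derivative_eq_intros)
  have "laplacian (\<lambda>x. E * Q \<bar>norm x * e\<bar>) y =
    (if y = 0 then real DIM('a) * (E * e * (Q2 (0 * e) * e))
     else E * e * (Q2 (norm y * e) * e) + (real DIM('a) - 1) / norm y * (E * (Q1 (norm y * e) * e)))"
    by (rule laplacian_radial[where G = "\<lambda>s. E * Q \<bar>s * e\<bar>"])
      (auto intro!: derivative_eq_intros DERIV_chain2[OF Q1] DERIV_chain2[OF Q2] scale)
  also have "\<dots> = - (E * e * e * Q (norm y * e) powr p)"
  proof (cases "y = 0")
    case True
    then show ?thesis using ode0 by (simp add: algebra_simps)
  next
    case False
    then have eq: "Q (norm y * e) powr p
        = - (Q2 (norm y * e) + (real DIM('a) - 1) / (norm y * e) * Q1 (norm y * e))"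
      using ode[of "norm y * e"] e by simp
    show ?thesis
      unfolding eq using False e by (simp add: field_simps)
  qed
  also have "\<dots> = - ((E * Q \<bar>norm y * e\<bar>) powr p)"
    using e Qpos[of "norm y * e"] by (simp add: powr_mult E_def Ep[unfolded E_def] less_imp_le)
  finally show ?thesis
    unfolding q_def[symmetric] dil by simp
qed

lemma Phi_eq_log_dilation:
  assumes "b t > 0" "1 + nu l a t z > 0" "r \<ge> 0"
  shows "Phi d p l Q a b t r z = log_dilation (2 / (p - 1)) (\<lambda>s. Q \<bar>s\<bar>)
    (ln (b t) / 2 + ln (1 + nu l a t z) / alpha_exp d p) r"
proof -
  have "D_scale d p l a b t z = exp (ln (b t) / 2 + ln (1 + nu l a t z) / alpha_exp d p)"
    using assms by (simp add: D_scale_def mu_def powr_def exp_add flip: powr_half_sqrt)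
  then show ?thesis
    using assms(3) by (simp add: Phi_def log_dilation_def powr_def exp_minus field_simps)
qed

section \<open>The equation satisfied by the modulated profile\<close>

theorem lemma3p1:
  fixes d l :: nat and p astar bstar \<tau>0 \<tau>s \<tau> z :: real
    and Q a b :: "real \<Rightarrow> real" and y :: "real ^ 'n"
  assumes "CARD('n) = d" and "d \<ge> 11" and "p \<ge> max 3 (p_JL d)"
    and "sqrt (Discr d p) > 2" and "real l > alpha_exp d p / 2"
    and "radial_profile d p Q"
    and "astar > 0" and "bstar > 0"
    and "\<And>c x. 0 < c \<Longrightarrow> c \<le> astar \<Longrightarrow> 1 + c * hermite_P (2 * l) x \<ge> 1 / 2"
    and "\<tau>0 < \<tau>s"
    and "C1_on {\<tau>0..\<tau>s} a" and "C1_on {\<tau>0..\<tau>s} b"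
    and "a ` {\<tau>0..\<tau>s} \<subseteq> {0<..astar}" and "b ` {\<tau>0..\<tau>s} \<subseteq> {0<..bstar}"
    and "\<tau> \<in> {\<tau>0..\<tau>s}"
  shows "dtime {\<tau>0..\<tau>s} (\<lambda>t. Phi d p l Q a b t (norm y) z) \<tau>
      - laplacian (\<lambda>Y. Phi d p l Q a b \<tau> (norm (fst Y)) (snd Y)) (y, z)
      + 1 / 2 * Lambda p (Phi d p l Q a b \<tau>) (norm y) z
      - Phi d p l Q a b \<tau> (norm y) z * \<bar>Phi d p l Q a b \<tau> (norm y) z\<bar> powr (p - 1)
    = Psi1 d p l Q {\<tau>0..\<tau>s} a b \<tau> (norm y) z"
proof -
  define T where "T = {\<tau>0..\<tau>s}"
  define q where "q = 2 / (p - 1)"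
  define \<alpha> where "\<alpha> = alpha_exp d p"
  define P where "P = hermite_P (2 * l)"
  define r where "r = norm y"
  define G where "G = (\<lambda>s. Q \<bar>s\<bar>)"
  have p: "p \<ge> 3" and \<tau>: "\<tau> \<in> T" and r: "r \<ge> 0"
    using assms by (auto simp: T_def r_def)
  have \<alpha>: "\<alpha> > 0"
    using alpha_exp_pos[OF assms(2) p] by (simp add: \<alpha>_def)
  have b: "b t > 0" if "t \<in> T" for t
    using that assms(14) unfolding T_def by fastforce
  have \<nu>: "nu l a t = (\<lambda>x. a t * P x)" for t
    by (simp add: nu_def P_def fun_eq_iff)
  have pos: "1 + a t * P x > 0" if "t \<in> T" for t x
  proof -
    have "a t \<in> {0<..astar}" using that assms(13) unfolding T_def by blast
    then have "1 + a t * P x \<ge> 1 / 2" using assms(9)[of "a t" x] by (simp add: P_def)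
    then show ?thesis by linarith
  qed
  have prof: "radial_profile DIM(real ^ 'n) p Q"
    using assms(1,6) by simp
  obtain G1 G2 where G1: "\<And>s. (G has_real_derivative G1 s) (at s)"
    and G2: "\<And>s. (G1 has_real_derivative G2 s) (at s)"
    using radial_profile_even_extension[OF assms(6)] unfolding G_def by metis
  \<comment> \<open>\<open>L\<close> and \<open>LL\<close> are \<open>\<Lambda>G\<close> and \<open>\<Lambda>\<^sup>2G\<close>, and \<open>L1\<close> is the derivative of \<open>\<Lambda>G\<close>.\<close>
  define L where "L s = q * G s + s * G1 s" for s
  define L1 where "L1 s = q * G1 s + (G1 s + s * G2 s)" for s
  define LL where "LL s = q * L s + s * L1 s" for s
  have L1: "(L has_real_derivative L1 s) (at s)" for s
    unfolding L_def L1_def by (auto intro!: derivative_eq_intros G1 G2)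
  define w where "w t x = ln (b t) / 2 + ln (1 + a t * P x) / \<alpha>" for t x
  have Phi: "Phi d p l Q a b t s x = log_dilation q G (w t x) s" if "t \<in> T" "s \<ge> 0" for t s x
    using Phi_eq_log_dilation[of b t l a x s d p Q] b pos that by (simp add: \<nu> q_def G_def w_def \<alpha>_def)

  obtain P1 P2 where P1: "\<And>z. (P has_real_derivative P1 z) (at z)"
    and P2: "\<And>z. (P1 has_real_derivative P2 z) (at z)"
    and hermite: "\<And>z. - P2 z + z / 2 * P1 z = real (2 * l) / 2 * P z"
    using hermite_P_ode[of "2 * l"] unfolding P_def by metis
  obtain a' b' where a': "(a has_real_derivative a') (at \<tau> within T)"
    and b': "(b has_real_derivative b') (at \<tau> within T)"
    using assms(11,12) \<tau> unfolding C1_on_def T_def by metis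
  have dtime_eqI: "dtime T f \<tau> = f'" if "(f has_real_derivative f') (at \<tau> within T)" for f f'
    using that assms(10) \<tau> unfolding dtime_def T_def
    by (intro vector_derivative_within_closed_interval) (simp_all add: has_real_derivative_iff_has_vector_derivative)

  define n where "n = 1 + a \<tau> * P z"
  have n: "n > 0" using pos[OF \<tau>] by (simp add: n_def)
  define X Y where "X = log_dilation q L (w \<tau> z) r" and "Y = log_dilation q LL (w \<tau> z) r"
  define \<Phi> where "\<Phi> = log_dilation q G (w \<tau> z) r"
  define u v where "u = a \<tau> * P1 z / n" and "v = a \<tau> * P2 z / n"

  have time: "dtime T (\<lambda>t. Phi d p l Q a b t r z) \<tau> = - (b' / b \<tau> / 2 + a' * P z / n / \<alpha>) * X"
  proof (rule dtime_eqI)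
    have "((\<lambda>t. w t z) has_real_derivative b' / b \<tau> / 2 + a' * P z / n / \<alpha>) (at \<tau> within T)"
      unfolding w_def n_def using b[OF \<tau>] pos[OF \<tau>, of z] \<alpha>
      by (auto intro!: derivative_eq_intros a' b')
    from log_dilation_has_derivative[OF G1 this, of q r]
    have "((\<lambda>t. log_dilation q G (w t z) r) has_real_derivative
        - (b' / b \<tau> / 2 + a' * P z / n / \<alpha>) * X) (at \<tau> within T)"
      by (simp add: X_def L_def[abs_def])
    then show "((\<lambda>t. Phi d p l Q a b t r z) has_real_derivative
        - (b' / b \<tau> / 2 + a' * P z / n / \<alpha>) * X) (at \<tau> within T)"
      by (rule has_field_derivative_transform_within[OF _ zero_less_one]) (use \<tau> r Phi in auto)
  qed

  define w1 where "w1 x = a \<tau> * P1 x / (1 + a \<tau> * P x) / \<alpha>" for x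
  have w1: "(w \<tau> has_real_derivative w1 x) (at x)" for x
    unfolding w_def w1_def using pos[OF \<tau>, of x] \<alpha> b[OF \<tau>]
    by (auto intro!: derivative_eq_intros P1)
  have w2: "(w1 has_real_derivative (v - u\<^sup>2) / \<alpha>) (at z)"
  proof -
    have n0: "1 + a \<tau> * P z \<noteq> 0" using n by (simp add: n_def)
    have num: "((\<lambda>x. a \<tau> * P1 x) has_real_derivative a \<tau> * P2 z) (at z)"
      and den: "((\<lambda>x. 1 + a \<tau> * P x) has_real_derivative a \<tau> * P1 z) (at z)"
      by (auto intro!: derivative_eq_intros P1 P2)
    have "(a \<tau> * P2 z * n - a \<tau> * P1 z * (a \<tau> * P1 z)) / (n * n) = v - u\<^sup>2"
      using n by (simp add: u_def v_def diff_divide_distrib power2_eq_square)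
    then show ?thesis
      using DERIV_cdivide[OF DERIV_divide[OF num den n0], of \<alpha>]
      by (simp add: w1_def[abs_def] n_def)
  qed
  have w1z: "w1 z = u / \<alpha>"
    by (simp add: w1_def u_def n_def)
  have Phi_z: "Phi d p l Q a b \<tau> r = (\<lambda>x. log_dilation q G (w \<tau> x) r)"
    using Phi[OF \<tau> r] by (simp add: fun_eq_iff)
  have dz: "((\<lambda>x. log_dilation q G (w \<tau> x) r) has_real_derivative
      - w1 x * log_dilation q L (w \<tau> x) r) (at x)" for x
    using log_dilation_has_derivative[OF G1 w1, of q r x] by (simp add: L_def[abs_def])
  have dLz: "((\<lambda>x. log_dilation q L (w \<tau> x) r) has_real_derivative - w1 z * Y) (at z)"
    using log_dilation_has_derivative[OF L1 w1, of q r z] by (simp add: LL_def[abs_def] Y_def)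
  have deriv_z: "deriv (Phi d p l Q a b \<tau> r) z = - (u / \<alpha>) * X"
    unfolding Phi_z using DERIV_imp_deriv[OF dz[of z]] by (simp add: w1z X_def)
  have deriv_zz: "(deriv ^^ 2) (Phi d p l Q a b \<tau> r) z = - ((v - u\<^sup>2) / \<alpha>) * X + (u / \<alpha>)\<^sup>2 * Y"
    unfolding Phi_z
  proof (rule second_deriv_eqI)
    show "((\<lambda>x. - w1 x * log_dilation q L (w \<tau> x) r) has_real_derivative
        - ((v - u\<^sup>2) / \<alpha>) * X + (u / \<alpha>)\<^sup>2 * Y) (at z)"
      by (rule derivative_eq_intros w2 dLz refl)+ (simp add: w1z X_def power2_eq_square)
  qed (use dz in simp)

  have lap: "laplacian (\<lambda>Y. Phi d p l Q a b \<tau> (norm (fst Y)) (snd Y)) (y, z)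
      = - (\<Phi> powr p) + (- ((v - u\<^sup>2) / \<alpha>) * X + (u / \<alpha>)\<^sup>2 * Y)"
    using laplacian_log_dilation_profile[OF prof, of "w \<tau> z" y] p deriv_zz
    by (subst laplacian_prod_real) (simp add: Phi[OF \<tau>] \<Phi>_def r_def q_def G_def)

  have "Q (norm y * exp (- w \<tau> z)) > 0"
    by (intro radial_profile_pos[OF assms(6)]) simp
  then have "\<Phi> > 0" by (simp add: \<Phi>_def log_dilation_def G_def r_def)
  then have nonlin: "\<Phi> * \<bar>\<Phi>\<bar> powr (p - 1) = \<Phi> powr p"
    by (simp add: powr_mult_base)

  have LrPhi: "Lambda_r p (\<lambda>s. Phi d p l Q a b \<tau> s z) r = X"
    using Lambda_r_scaled[of "\<lambda>s. Phi d p l Q a b \<tau> s z" "exp (- (q * w \<tau> z))" G "exp (- w \<tau> z)" G1 r p]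
      G1 r by (simp add: Phi[OF \<tau>] X_def L_def log_dilation_def q_def mult.commute)
  have Lam: "Lambda p (Phi d p l Q a b \<tau>) r z = X - z * (u / \<alpha>) * X"
    by (simp add: Lambda_def LrPhi deriv_z)

  \<comment> \<open>\<open>Q\<^sub>b\<close> evaluated at \<open>r/\<mu>\<close> is \<open>Q\<close> evaluated at \<open>r/D\<close>, up to the amplitude \<open>\<beta>\<close>; together with
    \<open>\<mu>\<^bsup>-q\<^esup>\<close> this amplitude is \<open>D\<^bsup>-q\<^esup>\<close>. So the terms of \<open>\<Psi>\<^sub>1\<close> reduce to \<open>X\<close> and \<open>Y\<close>.\<close>
  define \<beta> where "\<beta> = b \<tau> powr (- 1 / (p - 1))"
  define LQ where "LQ = Lambda_r p (Q_b p Q (b \<tau>))"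
  define \<mu> where "\<mu> = mu d p l a \<tau> z"
  have \<mu>: "\<mu> = exp (ln n / \<alpha>)" and sqrtb: "sqrt (b \<tau>) = exp (ln (b \<tau>) / 2)"
    using n b[OF \<tau>] by (simp_all add: \<mu>_def mu_def \<nu> powr_def n_def \<alpha>_def flip: powr_half_sqrt)
  have LQ: "LQ s = \<beta> * L (1 / sqrt (b \<tau>) * s)" if "s \<ge> 0" for s
    unfolding LQ_def L_def q_def using G1 that b[OF \<tau>]
    by (intro Lambda_r_scaled) (auto simp: Q_b_def \<beta>_def G_def)
  have LLQ: "Lambda_r p LQ s = \<beta> * LL (1 / sqrt (b \<tau>) * s)" if "s \<ge> 0" for s
    unfolding LL_def q_def using L1 that LQ by (intro Lambda_r_scaled) auto
  have w_eq: "w \<tau> z = ln (b \<tau>) / 2 + ln n / \<alpha>"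
    by (simp add: w_def n_def)
  have \<xi>: "1 / sqrt (b \<tau>) * (r / \<mu>) = r * exp (- w \<tau> z)"
  proof -
    have "exp (w \<tau> z) = sqrt (b \<tau>) * \<mu>"
      unfolding w_eq exp_add \<mu> sqrtb ..
    then show ?thesis by (simp add: exp_minus field_simps)
  qed
  have amp: "1 / \<mu> powr q * \<beta> = exp (- (q * w \<tau> z))"
  proof -
    have "1 / \<mu> powr q = exp (- (q * (ln n / \<alpha>)))"
      by (simp add: \<mu> powr_def exp_minus inverse_eq_divide)
    moreover have "\<beta> = exp (- (q * (ln (b \<tau>) / 2)))"
      using b[OF \<tau>] p by (simp add: \<beta>_def powr_def q_def field_simps)
    ultimately show ?thesis
      by (simp add: w_eq distrib_left mult_exp_exp)
  qed
  have \<mu>\<gamma>: "\<mu> powr gamma_exp d p = n * \<mu> powr q"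
  proof -
    have "gamma_exp d p = \<alpha> + q" by (simp add: \<alpha>_def alpha_exp_def q_def)
    then show ?thesis using n \<alpha> by (simp add: powr_add) (simp add: \<mu> powr_def)
  qed
  have rmu: "r / \<mu> \<ge> 0" using r by (simp add: \<mu>)
  define M where "M = \<mu> powr q"
  have M: "M > 0" by (simp add: M_def \<mu>)
  have X_eq: "LQ (r / \<mu>) = M * X"
    unfolding LQ[OF rmu] \<xi> using M by (simp add: X_def log_dilation_def M_def flip: amp)
  have Y_eq: "Lambda_r p LQ (r / \<mu>) = M * Y"
    unfolding LLQ[OF rmu] \<xi> using M by (simp add: Y_def log_dilation_def M_def flip: amp)
  have "deriv (nu l a \<tau>) z = a \<tau> * P1 z"
    unfolding \<nu> by (intro DERIV_imp_deriv DERIV_cmult P1)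
  then have "Psi1_tilde d p l Q a b \<tau> r z
      = real l / \<alpha> * (1 / (n * M) * (M * X) - LQ r)
        - 1 / \<alpha>\<^sup>2 * u\<^sup>2 * (1 / M) * (M * Y + \<alpha> * (M * X))"
    unfolding Psi1_tilde_def Let_def \<mu>_def[symmetric] LQ_def[symmetric] \<alpha>_def[symmetric]
      q_def[symmetric] \<mu>\<gamma> M_def[symmetric] X_eq Y_eq
    by (simp add: u_def n_def \<nu>)
  moreover have "1 / (n * M) * (M * X) = X / n"
    using M by simp
  moreover have "1 / M * (M * Y + \<alpha> * (M * X)) = Y + \<alpha> * X"
    using M by (simp add: field_simps)
  ultimately have tilde: "Psi1_tilde d p l Q a b \<tau> r z
      = real l / \<alpha> * (X / n - LQ r) - 1 / \<alpha>\<^sup>2 * u\<^sup>2 * (Y + \<alpha> * X)"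
    by (simp only: mult.assoc)
  have "dtime T b \<tau> = b'" and "dtime T (\<lambda>t. nu l a t z) \<tau> = a' * P z"
    using dtime_eqI[OF b'] dtime_eqI[OF DERIV_cmult_right[OF a', of "P z"]] by (simp_all add: \<nu>)
  then have Psi: "Psi1 d p l Q T a b \<tau> r z
      = (1 / 2 * (- b' / b \<tau> + 1) - real l / \<alpha> - 1 / \<alpha> * (a' * P z / n)) * X
        + real l / \<alpha> * LQ r
        + (real l / \<alpha> * (X / n - LQ r) - 1 / \<alpha>\<^sup>2 * u\<^sup>2 * (Y + \<alpha> * X))"
    by (simp add: Psi1_def Let_def LrPhi tilde) (simp add: LQ_def \<alpha>_def \<nu> n_def)
  \<comment> \<open>The Hermite equation, divided by \<open>1 + \<nu>\<close>, with \<open>\<nu> / (1 + \<nu>) = 1 - 1 / (1 + \<nu>)\<close>.\<close>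
  have "v - z / 2 * u = - (- P2 z + z / 2 * P1 z) * a \<tau> / n"
    using n by (simp add: u_def v_def field_simps)
  also have "\<dots> = - real l * (a \<tau> * P z) / n"
    unfolding hermite by simp
  also have "\<dots> = real l / n - real l"
    using n by (simp add: n_def field_simps)
  finally have v: "v = z / 2 * u + real l / n - real l" by simp
  show ?thesis
    unfolding T_def[symmetric] r_def[symmetric] time lap Lam Psi
    unfolding Phi[OF \<tau> r] \<Phi>_def[symmetric] nonlin v
    using \<alpha> by (simp add: add_divide_distrib diff_divide_distrib algebra_simps power2_eq_square)
qed

end
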